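(* Let $C$ be a nonempty closed convex subset of a real Hilbert space $H$, let $N\ge 1$, and let $f_1,\dots,f_N:C\times C\to\mathbb{R}$ be bifunctions each satisfying: (a) $f_i$ is pseudomonotone on $C$, and $f_i(x,x)=0$ for all $x\in C$; (b) $f_i$ is Lipschitz-type continuous on $C$ with constants $c_1,c_2>0$ (the same for all $i$); (c) $f_i$ is weakly continuous on $C$; (d) for each $x\in C$, $f_i(x,\cdot)$ is convex and subdifferentiable on $C$. Assume that $F=\bigcap_{i=1}^N EP(f_i,C)$ is nonempty. Let $\lambda,k$ be real numbers with $$0<\lambda<\frac{1}{2(c_1+c_2)},\qquad k>\frac{1}{1-2\lambda(c_1+c_2)}.$$ Choose $x_0=x_1\in H$ and $y_0^i=y_1^i\in C$ ($i=1,\dots,N$), set $C_0=Q_0=H$, and let the sequences $\{x_n\}\subset H$ and $\{y_n^i\}\subset C$ be generated, for $n=1,2,\dots$, by $$y_{n+1}^i=\operatorname*{argmin}_{y\in C}\Big\{\lambda f_i(y_n^i,y)+\tfrac12\|x_n-y\|^2\Big\},\quad i=1,\dots,N,\qquad x_{n+1}=P_{C_n\cap Q_n}(x_0),$$ where $$C_n=\bigcap_{i=1}^N C_n^i,\qquad C_n^i=\{z\in H:\|y_{n+1}^i-z\|^2\le\|x_n-z\|^2+\epsilon_n^i\},\qquad Q_n=\{z\in H:\langle x_0-x_n,z-x_n\rangle\le 0\},$$ $$\epsilon_n^i=k\|x_n-x_{n-1}\|^2+2\lambda c_1\|y_n^i-y_{n-1}^i\|^2-\Big(1-\frac1k-2\lambda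 c_2\Big)\|y_{n+1}^i-y_n^i\|^2 .$$ Then the sequences $\{x_n\}$ and $\{y_n^i\}$ ($i=1,\dots,N$) converge strongly (in norm) to $P_F(x_0)$.
   Context: For a bifunction $f:C\times C\to\mathbb{R}$: - $EP(f,C)=\{x^*\in C: f(x^*,y)\ge 0\ \ \forall y\in C\}$. - $f$ is pseudomonotone on $C$ if, for all $x,y\in C$, $f(x,y)\ge 0$ implies $f(y,x)\le 0$. - $f$ is Lipschitz-type continuous on $C$ with constants $c_1,c_2>0$ if $f(x,y)+f(y,z)\ge f(x,z)-c_1\|x-y\|^2-c_2\|y-z\|^2$ for all $x,y,z\in C$. - $f$ is weakly continuous on $C$ if $f(x_n,y_n)\to f(x,y)$ whenever $x_n,y_n,x,y\in C$ with $x_n\rightharpoonup x$ and $y_n\rightharpoonup y$ weakly in $H$. - $f(x,\cdot)$ is subdifferentiable on $C$ if for every $u\in C$ there is $w\in H$ with $f(x,v)-f(x,u)\ge\langle w,v-u\rangle$ for all $v\in C$. For a nonempty closed convex set $K\subset H$, $P_K(x)$ denotes the metric projection of $x$ onto $K$, i.e. the unique point of $K$ nearest to $x$. Under the stated hypotheses $F$ is closed and convex.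
   Formalization: Instead of an arbitrary y_0^i = y_1^i in C (for which the claim can fail), only y_0^i in C is chosen and y_1^i is the displayed argmin step at n=0, from x_0 and y_0^i; the x-update is also stated at n=0, where C_0=Q_0=H just gives x_1=x_0. *)

theory Defs
  imports "HOL-Analysis.Analysis"
begin

text \<open>
  A real Hilbert space is a type of sort \<open>{real_inner, complete_space}\<close>.  A bifunction on
  \<open>C \<times> C\<close> is a total function \<open>'a \<Rightarrow> 'a \<Rightarrow> real\<close>; only the values on \<open>C \<times> C\<close> are ever used.
\<close>

definition EP :: "('a \<Rightarrow> 'a \<Rightarrow> real) \<Rightarrow> 'a set \<Rightarrow> 'a set" where
  "EP f C = {u \<in> C. \<forall>v\<in>C. 0 \<le> f u v}"

definition pseudomonotone_on :: "'a set \<Rightarrow> ('a \<Rightarrow> 'a \<Rightarrow> real) \<Rightarrow> bool" where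
  "pseudomonotone_on C f \<longleftrightarrow> (\<forall>u\<in>C. \<forall>v\<in>C. 0 \<le> f u v \<longrightarrow> f v u \<le> 0)"

definition lipschitz_type_on ::
    "real \<Rightarrow> real \<Rightarrow> 'a::real_normed_vector set \<Rightarrow> ('a \<Rightarrow> 'a \<Rightarrow> real) \<Rightarrow> bool" where
  "lipschitz_type_on c1 c2 C f \<longleftrightarrow> (\<forall>u\<in>C. \<forall>v\<in>C. \<forall>w\<in>C.
     f u v + f v w \<ge> f u w - c1 * (norm (u - v))\<^sup>2 - c2 * (norm (v - w))\<^sup>2)"

text \<open>In a Hilbert space every bounded functional is an inner product with a fixed vector.\<close>

definition weakly_tendsto :: "(nat \<Rightarrow> 'a::real_inner) \<Rightarrow> 'a \<Rightarrow> bool" where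
  "weakly_tendsto u l \<longleftrightarrow> (\<forall>w. (\<lambda>n. u n \<bullet> w) \<longlonglongrightarrow> l \<bullet> w)"

definition weakly_continuous_on :: "'a::real_inner set \<Rightarrow> ('a \<Rightarrow> 'a \<Rightarrow> real) \<Rightarrow> bool" where
  "weakly_continuous_on C f \<longleftrightarrow>
     (\<forall>u v a b. range u \<subseteq> C \<longrightarrow> range v \<subseteq> C \<longrightarrow> a \<in> C \<longrightarrow> b \<in> C \<longrightarrow>
        weakly_tendsto u a \<longrightarrow> weakly_tendsto v b \<longrightarrow> (\<lambda>n. f (u n) (v n)) \<longlonglongrightarrow> f a b)"

definition subdifferentiable_on :: "'a::real_inner set \<Rightarrow> ('a \<Rightarrow> real) \<Rightarrow> bool" where
  "subdifferentiable_on C g \<longleftrightarrow> (\<forall>u\<in>C. \<exists>w. \<forall>v\<in>C. g v - g u \<ge> w \<bullet> (v - u))"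

text \<open>
  The metric projection.  The library's \<^const>\<open>closest_point\<close> requires a Heine-Borel
  (finite-dimensional) space.
\<close>

definition metric_proj :: "'a::metric_space set \<Rightarrow> 'a \<Rightarrow> 'a" where
  "metric_proj K a = (THE p. p \<in> K \<and> (\<forall>q\<in>K. dist a p \<le> dist a q))"

end

theory Submission
  imports Defs "HOL-Complex_Analysis.Great_Picard"
begin

text \<open>
  The variational inequalities of two consecutive proximal steps, combined with pseudomonotonicity,
  the Lipschitz-type condition and Young's inequality, show that \<open>F \<subseteq> C\<^sub>n\<close>; the projection inequality
  gives \<open>F \<subseteq> Q\<^sub>n\<close> by induction.  Hence \<open>\<parallel>x\<^sub>n - x\<^sub>0\<parallel>\<close> increases and is bounded by
  \<open>\<parallel>P\<^sub>F x\<^sub>0 - x\<^sub>0\<parallel>\<close>, so \<open>\<Sum> \<parallel>x\<^sub>n\<^sub>+\<^sub>1 - x\<^sub>n\<parallel>\<^sup>2 < \<infinity>\<close>.  Since \<open>x\<^sub>n\<^sub>+\<^sub>1 \<in> C\<^sub>n\<close>, the numbers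
  \<open>a\<^sub>n = \<parallel>y\<^sub>n\<^sub>+\<^sub>1 - y\<^sub>n\<parallel>\<^sup>2\<close> satisfy \<open>(1 - 1/k - 2\<lambda>c\<^sub>2) a\<^sub>n \<le> 2\<lambda>c\<^sub>1 a\<^sub>n\<^sub>-\<^sub>1 + (summable)\<close>; the condition on \<open>k\<close>
  makes this a contraction, whence \<open>a\<^sub>n \<rightarrow> 0\<close> and \<open>y\<^sub>n - x\<^sub>n \<rightarrow> 0\<close>.  Passing to the weak limit in the
  variational inequality, every weak cluster point of \<open>x\<^sub>n\<close> lies in \<open>F\<close>, and the norm bound turns weak
  into strong convergence.
\<close>

section \<open>Proximal points and projections in Hilbert space\<close>

text \<open>Minimizing sequences are Cauchy: the midpoint of two almost minimal points cannot fall
  below the infimum, so \<open>mid\<close> forces the points together. Completeness takes the place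
  of compactness. The factor 1/8 is half of the 1/4 in \<open>norm_sq_midpoint\<close>, since the
  proximal objective carries half a squared norm.\<close>

lemma uniformly_convex_minimizer:
  fixes h :: "'a::{real_inner, complete_space} \<Rightarrow> real"
  assumes C: "closed C" "convex C" "C \<noteq> {}"
    and cont: "continuous_on C h"
    and lower: "\<And>v. v \<in> C \<Longrightarrow> m \<le> h v"
    and mid: "\<And>u v. u \<in> C \<Longrightarrow> v \<in> C \<Longrightarrow>
      h ((1/2) *\<^sub>R u + (1/2) *\<^sub>R v) \<le> (h u + h v) / 2 - (norm (u - v))\<^sup>2 / 8"
  obtains p where "p \<in> C" "\<And>v. v \<in> C \<Longrightarrow> h p \<le> h v"
proof -
  define I where "I = Inf (h ` C)"
  have bdd: "bdd_below (h ` C)"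
    using lower by (auto intro!: bdd_belowI)
  have I_le: "I \<le> h v" if "v \<in> C" for v
    unfolding I_def using bdd that by (intro cInf_lower) auto
  define d where "d n = 1 / (real n + 1)" for n :: nat
  have "\<exists>u\<in>C. h u < I + d n" for n
  proof -
    have "Inf (h ` C) < I + d n"
      unfolding I_def d_def by (simp add: add_pos_nonneg)
    then show ?thesis
      using cInf_less_iff[of "h ` C"] C bdd by auto
  qed
  then obtain u where u: "\<And>n. u n \<in> C" "\<And>n. h (u n) < I + d n"
    by metis
  have near: "(norm (u n - u j))\<^sup>2 \<le> 4 * d n + 4 * d j" for n j
  proof -
    have "(1/2) *\<^sub>R u n + (1/2) *\<^sub>R u j \<in> C"
      using C(2) u(1) by (auto simp: convex_def)
    then have "I \<le> (h (u n) + h (u j)) / 2 - (norm (u n - u j))\<^sup>2 / 8"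
      using I_le mid[OF u(1) u(1)] order_trans by blast
    then show ?thesis using u(2)[of n] u(2)[of j] by (simp add: field_simps)
  qed
  have "Cauchy u"
  proof (rule metric_CauchyI)
    fix e :: real assume "e > 0"
    then obtain M where M: "8 / e\<^sup>2 < real M" using reals_Archimedean2 by blast
    have "dist (u n) (u j) < e" if "n \<ge> M" "j \<ge> M" for n j
    proof -
      have "4 * d n \<le> 4 * d M" "4 * d j \<le> 4 * d M"
        using that by (auto simp: d_def intro!: divide_left_mono)
      then have "(norm (u n - u j))\<^sup>2 \<le> 8 * d M" using near[of n j] by simp
      also have "\<dots> < e\<^sup>2"
        using M \<open>e > 0\<close> by (simp add: d_def field_simps add_strict_increasing)
      finally show ?thesis
        using \<open>e > 0\<close> by (simp add: dist_norm power_less_imp_less_base)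
    qed
    then show "\<exists>M. \<forall>m\<ge>M. \<forall>n\<ge>M. dist (u m) (u n) < e" by blast
  qed
  then obtain p where p: "u \<longlonglongrightarrow> p"
    using Cauchy_convergent convergent_def by blast
  have pC: "p \<in> C" using closed_sequentially[OF C(1)] u(1) p by blast
  have "(\<lambda>n. h (u n)) \<longlonglongrightarrow> h p"
    using continuous_on_tendsto_compose[OF cont p pC] u(1) by simp
  moreover have "(\<lambda>n. I + d n) \<longlonglongrightarrow> I"
    using tendsto_add[OF tendsto_const LIMSEQ_inverse_real_of_nat, of I]
    by (simp add: d_def inverse_eq_divide add.commute)
  ultimately have "h p \<le> I"
    by (rule LIMSEQ_le) (use u(2) less_imp_le in blast)
  then show ?thesis using that pC I_le order_trans by blast
qed

lemma norm_sq_midpoint: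
  fixes a u v :: "'a::real_inner"
  shows "(norm (a - ((1/2) *\<^sub>R u + (1/2) *\<^sub>R v)))\<^sup>2 =
    ((norm (a - u))\<^sup>2 + (norm (a - v))\<^sup>2) / 2 - (norm (u - v))\<^sup>2 / 4"
  by (simp add: power2_norm_eq_inner inner_diff_left inner_diff_right inner_add_left
      inner_add_right inner_commute field_simps)

text \<open>Convexity of \<open>g\<close> and the squared norm give the midpoint inequality; a
  subgradient of \<open>g\<close> supplies the lower bound.\<close>

lemma prox_exists:
  fixes g :: "'a::{real_inner, complete_space} \<Rightarrow> real"
  assumes C: "closed C" "convex C" "C \<noteq> {}"
    and g: "continuous_on C g" "convex_on C g" "subdifferentiable_on C g"
  obtains p where "p \<in> C"
    "\<And>v. v \<in> C \<Longrightarrow> g p + 1/2 * (norm (a - p))\<^sup>2 \<le> g v + 1/2 * (norm (a - v))\<^sup>2"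
proof -
  obtain u where u: "u \<in> C" using C by blast
  obtain w where w: "\<And>v. v \<in> C \<Longrightarrow> g v - g u \<ge> w \<bullet> (v - u)"
    using g(3) u unfolding subdifferentiable_on_def by blast
  show ?thesis
  proof (rule uniformly_convex_minimizer[OF C, of "\<lambda>v. g v + 1/2 * (norm (a - v))\<^sup>2"])
    show "continuous_on C (\<lambda>v. g v + 1/2 * (norm (a - v))\<^sup>2)"
      by (intro continuous_intros g)
    \<comment> \<open>Minimum of the affine minorant plus the quadratic, found by completing the
      square in \<open>w - (a - v)\<close>.\<close>
    show "g u + w \<bullet> (a - u) - 1/2 * (norm w)\<^sup>2 \<le> g v + 1/2 * (norm (a - v))\<^sup>2"
      if "v \<in> C" for v
    proof -
      have "(norm (w - (a - v)))\<^sup>2 = (norm w)\<^sup>2 - 2 * (w \<bullet> (a - v)) + (norm (a - v))\<^sup>2"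
        by (simp add: power2_norm_eq_inner inner_diff_left inner_diff_right inner_commute)
      moreover have "w \<bullet> (v - u) = w \<bullet> (a - u) - w \<bullet> (a - v)"
        by (simp add: inner_diff_right)
      ultimately show ?thesis
        using w[OF that] zero_le_power2[of "norm (w - (a - v))"] by linarith
    qed
    show "g ((1/2) *\<^sub>R u + (1/2) *\<^sub>R v) + 1/2 * (norm (a - ((1/2) *\<^sub>R u + (1/2) *\<^sub>R v)))\<^sup>2
       \<le> (g u + 1/2 * (norm (a - u))\<^sup>2 + (g v + 1/2 * (norm (a - v))\<^sup>2)) / 2 - (norm (u - v))\<^sup>2 / 8"
      if "u \<in> C" "v \<in> C" for u v
      using convex_onD[OF g(2), of "1/2" u v] that unfolding norm_sq_midpoint by (simp add: field_simps)
  qed (use that in blast)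
qed

text \<open>Comparing \<open>p\<close> with the point at parameter \<open>t\<close> on the segment
  to \<open>v\<close> and dividing by \<open>t\<close> leaves \<open>D\<close> plus a term of order
  \<open>t\<close>, which vanishes as \<open>t\<close> tends to 0.\<close>

lemma prox_variational:
  fixes g :: "'a::real_inner \<Rightarrow> real"
  assumes g: "convex_on C g" and p: "p \<in> C" and v: "v \<in> C"
    and min: "\<And>v. v \<in> C \<Longrightarrow> g p + 1/2 * (norm (a - p))\<^sup>2 \<le> g v + 1/2 * (norm (a - v))\<^sup>2"
  shows "(a - p) \<bullet> (v - p) \<le> g v - g p"
proof -
  define D where "D = g v - g p - (a - p) \<bullet> (v - p)"
  have expand: "(norm (b - t *\<^sub>R q))\<^sup>2 = (norm b)\<^sup>2 - 2 * t * (b \<bullet> q) + t\<^sup>2 * (norm q)\<^sup>2" for b q :: 'a and t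
    by (simp only: power2_norm_eq_inner) (simp add: inner_diff_left inner_diff_right inner_commute
        power2_eq_square algebra_simps)
  have D: "0 \<le> D + t * ((norm (v - p))\<^sup>2 / 2)" if t: "0 < t" "t \<le> 1" for t
  proof -
    let ?z = "(1 - t) *\<^sub>R p + t *\<^sub>R v"
    have "?z \<in> C" using convex_on_imp_convex[OF g] p v t by (auto simp: convex_def)
    then have "g p + 1/2 * (norm (a - p))\<^sup>2 \<le> g ?z + 1/2 * (norm (a - ?z))\<^sup>2"
      by (rule min)
    also have "g ?z \<le> (1 - t) * g p + t * g v" using convex_onD[OF g, of t p v] t p v by simp
    also have "a - ?z = (a - p) - t *\<^sub>R (v - p)" by (simp add: algebra_simps)
    also have "(norm \<dots>)\<^sup>2 = (norm (a - p))\<^sup>2 - 2 * t * ((a - p) \<bullet> (v - p)) + t\<^sup>2 * (norm (v - p))\<^sup>2"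
      by (rule expand)
    finally have "0 \<le> t * (D + t * ((norm (v - p))\<^sup>2 / 2))"
      unfolding D_def by (simp add: algebra_simps power2_eq_square)
    then show ?thesis using t by (simp add: zero_le_mult_iff)
  qed
  have "(\<lambda>n. D + inverse (real (Suc n)) * ((norm (v - p))\<^sup>2 / 2)) \<longlonglongrightarrow> D + 0 * ((norm (v - p))\<^sup>2 / 2)"
    by (intro tendsto_intros LIMSEQ_inverse_real_of_nat)
  then have "0 \<le> D + 0 * ((norm (v - p))\<^sup>2 / 2)"
    by (rule LIMSEQ_le_const) (use D[of "inverse (real (Suc n))" for n] in \<open>auto simp: field_simps\<close>)
  then show ?thesis by (simp add: D_def)
qed

text \<open>The projection is the proximal point of the zero function. Adding the variational
  inequalities of two nearest points shows that they coincide, as \<open>THE\<close> in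
  \<open>metric_proj\<close> requires.\<close>

lemma metric_proj_variational:
  fixes K :: "'a::{real_inner, complete_space} set"
  assumes K: "closed K" "convex K" "K \<noteq> {}"
  shows "metric_proj K a \<in> K"
    and "\<And>v. v \<in> K \<Longrightarrow> (a - metric_proj K a) \<bullet> (v - metric_proj K a) \<le> 0"
proof -
  have zero: "convex_on K (\<lambda>_. 0 :: real)" "subdifferentiable_on K (\<lambda>_. 0)"
    using K by (auto simp: convex_on_def subdifferentiable_on_def intro: exI[of _ 0])
  have half: "0 + 1/2 * (norm (a - q))\<^sup>2 \<le> 0 + 1/2 * (norm (a - v))\<^sup>2 \<longleftrightarrow> dist a q \<le> dist a v" for q v :: 'a
    by (simp add: dist_norm)
  have var: "(a - q) \<bullet> (v - q) \<le> 0"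
    if "q \<in> K" "v \<in> K" "\<forall>v\<in>K. dist a q \<le> dist a v" for q v
    using prox_variational[OF zero(1) that(1,2), of a] that(3) unfolding half by simp
  obtain p where "p \<in> K"
    and "\<And>v. v \<in> K \<Longrightarrow> 0 + 1/2 * (norm (a - p))\<^sup>2 \<le> 0 + 1/2 * (norm (a - v))\<^sup>2"
    using prox_exists[OF K continuous_on_const zero, of a] by metis
  then have p: "p \<in> K" "\<forall>v\<in>K. dist a p \<le> dist a v" unfolding half by auto
  have uniq: "q = p" if q: "q \<in> K" "\<forall>v\<in>K. dist a q \<le> dist a v" for q
  proof -
    have "(q - p) \<bullet> (q - p) = (a - p) \<bullet> (q - p) + (a - q) \<bullet> (p - q)"
      by (simp add: inner_diff_left inner_diff_right inner_commute)
    also have "\<dots> \<le> 0" using var[OF p(1) q(1) p(2)] var[OF q(1) p(1) q(2)] by simp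
    finally show ?thesis by (metis inner_gt_zero_iff linorder_not_less right_minus_eq)
  qed
  have eq: "metric_proj K a = p"
    unfolding metric_proj_def by (rule the_equality) (use p uniq in blast)+
  show "metric_proj K a \<in> K" unfolding eq by (rule p(1))
  show "(a - metric_proj K a) \<bullet> (v - metric_proj K a) \<le> 0" if "v \<in> K" for v
    unfolding eq by (rule var[OF p(1) that p(2)])
qed

lemma norm_sq_metric_proj:
  fixes K :: "'a::{real_inner, complete_space} set"
  assumes K: "closed K" "convex K" and v: "v \<in> K"
  shows "(norm (v - metric_proj K a))\<^sup>2 \<le> (norm (v - a))\<^sup>2 - (norm (metric_proj K a - a))\<^sup>2"
proof -
  have "(norm (v - metric_proj K a))\<^sup>2 = (norm (v - a))\<^sup>2 - (norm (metric_proj K a - a))\<^sup>2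
      + 2 * ((a - metric_proj K a) \<bullet> (v - metric_proj K a))"
    by (simp add: power2_norm_eq_inner inner_diff_left inner_diff_right inner_commute)
  then show ?thesis using metric_proj_variational(2)[of K v a] assms by auto
qed

section \<open>Weak sequential compactness\<close>

text \<open>The functionals given by \<open>u n\<close> have the common Lipschitz constant
  \<open>B\<close>, so the Cauchy property survives limits in \<open>w\<close> by a three-epsilon
  argument.\<close>

lemma closed_convergent_inner:
  fixes u :: "nat \<Rightarrow> 'a::real_inner"
  assumes B: "\<And>n. norm (u n) \<le> B"
  shows "closed {w. convergent (\<lambda>n. u n \<bullet> w)}" (is "closed ?V")
proof (rule closed_sequential_limits[THEN iffD2], intro allI impI, elim conjE)
  fix w l assume w: "\<forall>n. w n \<in> ?V" "w \<longlonglongrightarrow> l"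
  have B0: "0 \<le> B" using B[of 0] norm_ge_zero order_trans by blast
  have "Cauchy (\<lambda>n. u n \<bullet> l)"
  proof (rule metric_CauchyI)
    fix e :: real assume e: "e > 0"
    \<comment> \<open>The \<open>+ 1\<close> keeps the divisor positive when
      \<open>B = 0\<close>.\<close>
    define d where "d = e / (3 * (B + 1))"
    have d: "d > 0" "B * d < e / 3" using e B0 by (auto simp: d_def field_simps add_nonneg_pos)
    obtain j where j: "norm (w j - l) < d"
      using w(2) d(1) by (meson LIMSEQ_D order_refl)
    have close: "\<bar>u n \<bullet> w j - u n \<bullet> l\<bar> < e / 3" for n
    proof -
      have "\<bar>u n \<bullet> w j - u n \<bullet> l\<bar> = \<bar>u n \<bullet> (w j - l)\<bar>" by (simp add: inner_diff_right)
      also have "\<dots> \<le> norm (u n) * norm (w j - l)" by (rule Cauchy_Schwarz_ineq2)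
      also have "\<dots> \<le> B * d" using B j B0 by (intro mult_mono) auto
      finally show ?thesis using d(2) by simp
    qed
    have "Cauchy (\<lambda>n. u n \<bullet> w j)" using w(1) convergent_Cauchy by blast
    then obtain M where M: "\<And>m n. m \<ge> M \<Longrightarrow> n \<ge> M \<Longrightarrow> dist (u m \<bullet> w j) (u n \<bullet> w j) < e / 3"
      using e metric_CauchyD[of _ "e/3"] by (metis divide_pos_pos zero_less_numeral)
    have "dist (u m \<bullet> l) (u n \<bullet> l) < e" if "m \<ge> M" "n \<ge> M" for m n
      using M[OF that] close[of m] close[of n] unfolding dist_real_def by linarith
    then show "\<exists>M. \<forall>m\<ge>M. \<forall>n\<ge>M. dist (u m \<bullet> l) (u n \<bullet> l) < e" by blast
  qed
  then show "l \<in> ?V" by (simp add: Cauchy_convergent)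
qed

text \<open>The points of least norm have increasing, bounded norms;
  \<open>norm_sq_metric_proj\<close> turns convergence of the squared norms into the Cauchy property
  of the points, and their limit lies in every set.\<close>

lemma nested_closed_convex_Inter_nonempty:
  fixes K :: "nat \<Rightarrow> 'a::{real_inner, complete_space} set"
  assumes K: "\<And>n. closed (K n)" "\<And>n. convex (K n)" "\<And>n. K n \<noteq> {}"
    and anti: "antimono K" and B: "\<And>v. v \<in> K 0 \<Longrightarrow> norm v \<le> B"
  shows "(\<Inter>n. K n) \<noteq> {}"
proof -
  define p where "p n = metric_proj (K n) 0" for n
  have p: "p n \<in> K n" for n unfolding p_def by (intro metric_proj_variational K)
  have le: "(norm (p j - p n))\<^sup>2 \<le> (norm (p j))\<^sup>2 - (norm (p n))\<^sup>2" if "n \<le> j" for n j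
    using norm_sq_metric_proj[OF K(1,2), of "p j" n 0] antimonoD[OF anti that] p[of j]
    by (auto simp: p_def)
  have "norm (p n) \<le> B" for n using B antimonoD[OF anti, of 0 n] p[of n] by auto
  then have "(norm (p n))\<^sup>2 \<le> B\<^sup>2" for n by (simp add: power_mono)
  moreover have "incseq (\<lambda>n. (norm (p n))\<^sup>2)"
  proof (rule monoI)
    fix n j :: nat assume "n \<le> j"
    then show "(norm (p n))\<^sup>2 \<le> (norm (p j))\<^sup>2"
      using le[of n j] zero_le_power2[of "norm (p j - p n)"] by linarith
  qed
  ultimately have "convergent (\<lambda>n. (norm (p n))\<^sup>2)"
    by (metis incseq_convergent convergent_def)
  then have Cau: "Cauchy (\<lambda>n. (norm (p n))\<^sup>2)" by (rule convergent_Cauchy)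
  have "Cauchy p"
  proof (rule metric_CauchyI)
    fix e :: real assume e: "e > 0"
    then obtain M where M: "\<And>m n. m \<ge> M \<Longrightarrow> n \<ge> M \<Longrightarrow> dist ((norm (p m))\<^sup>2) ((norm (p n))\<^sup>2) < e\<^sup>2"
      using metric_CauchyD[OF Cau, of "e\<^sup>2"] by auto
    have *: "dist (p j) (p n) < e" if "n \<ge> M" "n \<le> j" for n j
    proof -
      have "(norm (p j - p n))\<^sup>2 < e\<^sup>2"
        using le[OF that(2)] M[of j n] that unfolding dist_real_def by linarith
      then show ?thesis using e by (simp add: dist_norm power_less_imp_less_base)
    qed
    then have "dist (p m) (p n) < e" if "n \<ge> M" "m \<ge> M" for m n
      using that by (metis dist_commute nat_le_linear)
    then show "\<exists>M. \<forall>m\<ge>M. \<forall>n\<ge>M. dist (p m) (p n) < e" by blast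
  qed
  then obtain l where l: "p \<longlonglongrightarrow> l" using Cauchy_convergent convergent_def by blast
  have "l \<in> K n" for n
  proof (rule Lim_in_closed_set[OF K(1) _ _ l])
    show "\<forall>\<^sub>F j in sequentially. p j \<in> K n"
      using eventually_ge_at_top[of n] by eventually_elim (use antimonoD[OF anti] p in blast)
  qed simp
  then show ?thesis by blast
qed

text \<open>
  No Riesz representation is needed: a diagonal argument makes \<open>u (r n) \<bullet> w\<close> converge for \<open>w\<close> in the
  closed span of the sequence, orthogonal projection extends this to all \<open>w\<close>, and the weak limit is
  a common point of the closed convex hulls of the tails.
\<close>

lemma bounded_weakly_convergent_subsequence:
  fixes u :: "nat \<Rightarrow> 'a::{real_inner, complete_space}"
  assumes B: "\<And>n. norm (u n) \<le> B"
  obtains r l where "strict_mono r" "weakly_tendsto (u \<circ> r) l"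
proof -
  have B0: "0 \<le> B" using B[of 0] norm_ge_zero order_trans by blast
  have "norm (u n \<bullet> w) \<le> B * B" if "w \<in> range u" for n w
  proof -
    have "norm (u n \<bullet> w) \<le> norm (u n) * norm w" by (simp add: Cauchy_Schwarz_ineq2)
    also have "\<dots> \<le> B * B" using that B B0 by (intro mult_mono) auto
    finally show ?thesis .
  qed
  \<comment> \<open>The diagonal argument runs over the countable set \<open>range u\<close>, with
    \<open>u n\<close> read as the function sending \<open>w\<close> to
    \<open>u n \<bullet> w\<close>.\<close>
  then obtain r :: "nat \<Rightarrow> nat" where r: "strict_mono r"
    and conv: "\<And>w. w \<in> range u \<Longrightarrow> \<exists>l. (\<lambda>n. u (r n) \<bullet> w) \<longlonglongrightarrow> l"
    using function_convergent_subsequence[of "range u" "\<lambda>n w. u n \<bullet> w"] by (metis countableI_type countable_image)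
  define V where "V = {w. convergent (\<lambda>n. u (r n) \<bullet> w)}"
  have V_closed: "closed V"
    unfolding V_def by (rule closed_convergent_inner) (rule B)
  have V_sub: "subspace V"
    unfolding V_def subspace_def
    by (auto simp: inner_add_right convergent_const intro: convergent_add convergent_mult convergent_const)
  have uV: "u n \<in> V" for n
    unfolding V_def convergent_def using conv by blast
  have V_all: "convergent (\<lambda>n. u (r n) \<bullet> w)" for w
  proof -
    define p where "p = metric_proj V w"
    have V: "closed V" "convex V" "V \<noteq> {}" using V_closed V_sub uV subspace_imp_convex by auto
    note pV = metric_proj_variational(2)[OF V, where a = w, folded p_def]
    have p: "p \<in> V" unfolding p_def by (rule metric_proj_variational[OF V])
    \<comment> \<open>\<open>V\<close> is a subspace, so both signs of \<open>v\<close> are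
      admissible and the projection inequality becomes orthogonality.\<close>
    have "(w - p) \<bullet> v = 0" if v: "v \<in> V" for v
    proof -
      have "p + v \<in> V" "p - v \<in> V" using V_sub p v by (auto intro: subspace_add subspace_diff)
      from pV[OF this(1)] pV[OF this(2)] show ?thesis by simp
    qed
    then have "u (r n) \<bullet> w = u (r n) \<bullet> p" for n
      using uV[of "r n"] by (metis inner_commute inner_diff_right right_minus_eq)
    then show ?thesis using p by (simp add: V_def)
  qed
  define K where "K n = closure (convex hull ((u \<circ> r) ` {n..}))" for n
  have "(\<Inter>n. K n) \<noteq> {}"
  proof (rule nested_closed_convex_Inter_nonempty)
    show "antimono K"
      unfolding K_def by (intro antimonoI closure_mono hull_mono image_mono) auto
    show "norm v \<le> B" if "v \<in> K 0" for v
    proof -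
      have "K 0 \<subseteq> cball 0 B"
        unfolding K_def by (intro closure_minimal hull_minimal) (auto simp: B)
      then show ?thesis using that by auto
    qed
  qed (auto simp: K_def intro!: convex_closure)
  then obtain l where l: "\<And>n. l \<in> K n" by blast
  have "(\<lambda>n. u (r n) \<bullet> w) \<longlonglongrightarrow> l \<bullet> w" for w
  proof -
    obtain c where c: "(\<lambda>n. u (r n) \<bullet> w) \<longlonglongrightarrow> c" using V_all convergent_def by blast
    have "\<bar>l \<bullet> w - c\<bar> \<le> e" if e: "e > 0" for e
    proof -
      obtain M where M: "\<And>n. n \<ge> M \<Longrightarrow> \<bar>u (r n) \<bullet> w - c\<bar> < e"
        using LIMSEQ_D[OF c e] by auto
      \<comment> \<open>A closed convex slab that contains the tail contains \<open>K M\<close>,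
        hence also \<open>l\<close>.\<close>
      have "K M \<subseteq> {v. w \<bullet> v \<le> c + e} \<inter> {v. w \<bullet> v \<ge> c - e}"
        unfolding K_def
      proof (intro closure_minimal hull_minimal)
        show "(u \<circ> r) ` {M..} \<subseteq> {v. w \<bullet> v \<le> c + e} \<inter> {v. w \<bullet> v \<ge> c - e}"
          using M by (force simp: inner_commute abs_less_iff)
      qed (auto intro!: convex_Int convex_halfspace_le convex_halfspace_ge closed_Int
          closed_halfspace_le closed_halfspace_ge)
      then show ?thesis using l[of M] by (auto simp: inner_commute abs_le_iff)
    qed
    then have "l \<bullet> w = c" by (metis abs_le_zero_iff dense_ge right_minus_eq)
    then show ?thesis using c by simp
  qed
  then have "weakly_tendsto (u \<circ> r) l" by (simp add: weakly_tendsto_def)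
  then show ?thesis using that r by blast
qed

section \<open>Weak limits and weakly continuous bifunctions\<close>

lemma weakly_tendstoD: "weakly_tendsto u l \<Longrightarrow> (\<lambda>n. u n \<bullet> w) \<longlonglongrightarrow> l \<bullet> w"
  by (simp add: weakly_tendsto_def)

lemma tendsto_imp_weakly_tendsto:
  "u \<longlonglongrightarrow> l \<Longrightarrow> weakly_tendsto u l"
  unfolding weakly_tendsto_def by (auto intro!: tendsto_intros)

lemma weakly_tendsto_transfer:
  assumes u: "weakly_tendsto u l" and d: "(\<lambda>n. v n - u n) \<longlonglongrightarrow> 0"
  shows "weakly_tendsto v l"
  unfolding weakly_tendsto_def
proof
  fix w
  have "(\<lambda>n. u n \<bullet> w + (v n - u n) \<bullet> w) \<longlonglongrightarrow> l \<bullet> w + 0 \<bullet> w"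
    by (intro tendsto_add weakly_tendstoD[OF u] tendsto_inner d tendsto_const)
  then show "(\<lambda>n. v n \<bullet> w) \<longlonglongrightarrow> l \<bullet> w" by (simp add: inner_diff_left)
qed

text \<open>Weak convergence is tested against \<open>l - q\<close>, with \<open>q\<close> the
  projection of \<open>l\<close>; the projection inequality then forces
  \<open>l = q\<close>.\<close>

lemma weakly_closed:
  fixes C :: "'a::{real_inner, complete_space} set"
  assumes C: "closed C" "convex C" and u: "\<And>n. u n \<in> C" "weakly_tendsto u l"
  shows "l \<in> C"
proof -
  define q where "q = metric_proj C l"
  have ne: "C \<noteq> {}" using u by blast
  have "(\<lambda>n. (u n - q) \<bullet> (l - q)) \<longlonglongrightarrow> (l - q) \<bullet> (l - q)"
    unfolding inner_diff_left by (intro tendsto_diff weakly_tendstoD[OF u(2)] tendsto_const)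
  then have "(l - q) \<bullet> (l - q) \<le> 0"
    by (rule LIMSEQ_le_const2)
      (use metric_proj_variational(2)[OF C ne u(1), of l] in \<open>auto simp: q_def inner_commute\<close>)
  then have "l = q" by (metis inner_gt_zero_iff linorder_not_less right_minus_eq)
  then show ?thesis using metric_proj_variational(1)[OF C ne] unfolding q_def by metis
qed

lemma weakly_continuous_on_tendsto:
  assumes f: "weakly_continuous_on C f"
    and "\<And>n. u n \<in> C" "\<And>n. v n \<in> C" "a \<in> C" "b \<in> C" "weakly_tendsto u a" "weakly_tendsto v b"
  shows "(\<lambda>n. f (u n) (v n)) \<longlonglongrightarrow> f a b"
  using assms unfolding weakly_continuous_on_def by (simp add: image_subset_iff)

lemma weakly_continuous_on_imp_continuous_on:
  assumes f: "weakly_continuous_on C f" and a: "a \<in> C"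
  shows "continuous_on C (f a)" "continuous_on C (\<lambda>u. f u a)"
  unfolding continuous_on_sequentially comp_def
  by (auto intro!: weakly_continuous_on_tendsto[OF f] tendsto_imp_weakly_tendsto a)

section \<open>Equilibrium problems\<close>

text \<open>Minty's lemma. For the harder inclusion, take \<open>z\<close> on the segment from
  \<open>u\<close> to \<open>v\<close>: convexity, \<open>f z z = 0\<close> and
  \<open>f z u <= 0\<close> give \<open>f z v >= 0\<close>, and then \<open>z\<close> tends to
  \<open>u\<close>.\<close>

lemma EP_Minty:
  assumes C: "convex C" and pm: "pseudomonotone_on C f" and diag: "\<And>u. u \<in> C \<Longrightarrow> f u u = 0"
    and wc: "weakly_continuous_on C f" and cv: "\<And>u. u \<in> C \<Longrightarrow> convex_on C (f u)"
  shows "EP f C = {u \<in> C. \<forall>v\<in>C. f v u \<le> 0}"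
proof (intro subset_antisym subsetI)
  fix u assume "u \<in> EP f C"
  then show "u \<in> {u \<in> C. \<forall>v\<in>C. f v u \<le> 0}"
    using pm unfolding EP_def pseudomonotone_on_def by blast
next
  fix u assume "u \<in> {u \<in> C. \<forall>v\<in>C. f v u \<le> 0}"
  then have u: "u \<in> C" "\<And>v. v \<in> C \<Longrightarrow> f v u \<le> 0" by auto
  have "0 \<le> f u v" if v: "v \<in> C" for v
  proof -
    define t where "t n = inverse (real (Suc n))" for n
    have t: "0 < t n" "t n \<le> 1" for n by (auto simp: t_def field_simps)
    define z where "z n = (1 - t n) *\<^sub>R u + t n *\<^sub>R v" for n
    have zC: "z n \<in> C" for n
      unfolding z_def using C u v t[of n] by (auto simp: convex_def)
    have "0 \<le> f (z n) v" for n
    proof -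
      have "f (z n) (z n) \<le> (1 - t n) * f (z n) u + t n * f (z n) v"
        using convex_onD[OF cv[OF zC], of "t n" u v n] u v t[of n] by (simp add: z_def)
      moreover have "(1 - t n) * f (z n) u \<le> 0"
        using t[of n] u(2)[OF zC] by (simp add: mult_le_0_iff)
      ultimately have "0 \<le> t n * f (z n) v" using diag[OF zC, of n] by simp
      then show ?thesis using t[of n] by (simp add: zero_le_mult_iff)
    qed
    moreover have "z \<longlonglongrightarrow> (1 - 0) *\<^sub>R u + 0 *\<^sub>R v"
      unfolding z_def t_def by (intro tendsto_intros LIMSEQ_inverse_real_of_nat)
    then have "z \<longlonglongrightarrow> u" by simp
    then have "(\<lambda>n. f (z n) v) \<longlonglongrightarrow> f u v"
      by (rule continuous_on_tendsto_compose[OF weakly_continuous_on_imp_continuous_on(2)[OF wc v] _ u(1)])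
        (simp add: zC)
    ultimately show ?thesis by (auto intro: LIMSEQ_le_const)
  qed
  then show "u \<in> EP f C" using u by (simp add: EP_def)
qed

text \<open>In the dual form of \<open>EP_Minty\<close> the unknown sits in the second argument,
  where \<open>f v\<close> is convex and continuous, so the solution set is an intersection of
  closed convex sublevel sets.\<close>

lemma closed_convex_EP:
  assumes C: "closed C" "convex C" and pm: "pseudomonotone_on C f" and diag: "\<And>u. u \<in> C \<Longrightarrow> f u u = 0"
    and wc: "weakly_continuous_on C f" and cv: "\<And>u. u \<in> C \<Longrightarrow> convex_on C (f u)"
  shows "closed (EP f C)" "convex (EP f C)"
proof -
  have EP: "EP f C = C \<inter> (\<Inter>v\<in>C. {u \<in> C. f v u \<le> 0})"
    using EP_Minty[OF C(2) pm diag wc cv] by auto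
  have "closed {u \<in> C. f v u \<le> 0}" if "v \<in> C" for v
    using continuous_closed_preimage[OF weakly_continuous_on_imp_continuous_on(1)[OF wc that] C(1), of "{..0}"]
    by (simp add: vimage_def Int_def)
  then show "closed (EP f C)" unfolding EP using C by (intro closed_Int closed_INT) auto
  have "convex {u \<in> C. f v u \<le> 0}" if "v \<in> C" for v
  proof (rule convexI)
    fix s t :: real and p q
    assume *: "p \<in> {u \<in> C. f v u \<le> 0}" "q \<in> {u \<in> C. f v u \<le> 0}" "0 \<le> s" "0 \<le> t" "s + t = 1"
    then have "f v (s *\<^sub>R p + t *\<^sub>R q) \<le> s * f v p + t * f v q"
      using cv[OF that] unfolding convex_on_def by auto
    also have "\<dots> \<le> 0" using * by (simp add: add_nonpos_nonpos mult_nonneg_nonpos)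
    finally show "s *\<^sub>R p + t *\<^sub>R q \<in> {u \<in> C. f v u \<le> 0}"
      using * C(2) by (auto simp: convex_def)
  qed
  then show "convex (EP f C)" unfolding EP using C by (intro convex_Int convex_INT) auto
qed

text \<open>\<open>arg_min_on\<close> is a choice operator, so minimality of \<open>p\<close> is
  available only after \<open>prox_exists\<close> has produced some minimizer.\<close>

lemma prox_step:
  fixes g :: "'a::{real_inner, complete_space} \<Rightarrow> real"
  assumes C: "closed C" "convex C" "C \<noteq> {}" and lam: "lam > 0"
    and g: "continuous_on C g" "convex_on C g" "subdifferentiable_on C g"
    and p: "p = arg_min_on (\<lambda>v. lam * g v + 1/2 * (norm (a - v))\<^sup>2) C"
  shows "p \<in> C" "\<And>v. v \<in> C \<Longrightarrow> (a - p) \<bullet> (v - p) \<le> lam * (g v - g p)"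
proof -
  let ?h = "\<lambda>v. lam * g v + 1/2 * (norm (a - v))\<^sup>2"
  have cont: "continuous_on C (\<lambda>v. lam * g v)" by (intro continuous_intros g)
  have conv: "convex_on C (\<lambda>v. lam * g v)" using g(2) lam by (intro convex_on_cmul) auto
  have "\<exists>w. \<forall>v\<in>C. w \<bullet> (v - u) \<le> lam * g v - lam * g u" if "u \<in> C" for u
  proof -
    obtain w where "\<And>v. v \<in> C \<Longrightarrow> w \<bullet> (v - u) \<le> g v - g u"
      using g(3) \<open>u \<in> C\<close> unfolding subdifferentiable_on_def by blast
    then have "\<forall>v\<in>C. (lam *\<^sub>R w) \<bullet> (v - u) \<le> lam * g v - lam * g u"
      using lam by (simp flip: right_diff_distrib)
    then show ?thesis by blast
  qed
  then have sub: "subdifferentiable_on C (\<lambda>v. lam * g v)"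
    unfolding subdifferentiable_on_def by blast
  obtain m where m: "m \<in> C" "\<And>v. v \<in> C \<Longrightarrow> ?h m \<le> ?h v"
    using prox_exists[OF C cont conv sub, of a] by metis
  have min: "p \<in> C \<and> (\<forall>v\<in>C. ?h p \<le> ?h v)"
    unfolding p arg_min_on_def
    by (rule arg_minI[of "\<lambda>v. v \<in> C" m]) (use m in \<open>auto simp: not_less\<close>)
  then show "p \<in> C" by blast
  show "(a - p) \<bullet> (v - p) \<le> lam * (g v - g p)" if "v \<in> C" for v
    using prox_variational[OF conv _ that, of p a] min by (simp add: right_diff_distrib)
qed

text \<open>The source of \<open>eps\<close>, used for \<open>F\<close> inside \<open>Cs n\<close>.
  \<open>step1\<close> belongs to the proximal point \<open>y1\<close> of \<open>x0\<close>, tested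
  at \<open>y2\<close>; \<open>step2\<close> belongs to the proximal point \<open>y2\<close> of
  \<open>x1\<close>, tested at the solution \<open>z\<close>.\<close>

lemma two_prox_steps_estimate:
  fixes x0 x1 y0 y1 y2 z :: "'a::real_inner"
  assumes pm: "pseudomonotone_on C f" and lip: "lipschitz_type_on c1 c2 C f"
    and yC: "y0 \<in> C" "y1 \<in> C" "y2 \<in> C" and z: "z \<in> EP f C" and pos: "lam > 0" "k > 0"
    and step1: "(x0 - y1) \<bullet> (y2 - y1) \<le> lam * (f y0 y2 - f y0 y1)"
    and step2: "(x1 - y2) \<bullet> (z - y2) \<le> lam * (f y1 z - f y1 y2)"
  shows "(norm (y2 - z))\<^sup>2 \<le> (norm (x1 - z))\<^sup>2 + (k * (norm (x1 - x0))\<^sup>2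
      + 2 * lam * c1 * (norm (y1 - y0))\<^sup>2 - (1 - 1 / k - 2 * lam * c2) * (norm (y2 - y1))\<^sup>2)"
proof -
  have "f y1 z \<le> 0"
    using z pm yC unfolding EP_def pseudomonotone_on_def by blast
  then have "lam * f y1 z \<le> 0" using pos by (simp add: mult_le_0_iff)
  then have A: "(x1 - y2) \<bullet> (z - y2) \<le> - (lam * f y1 y2)"
    using step2 by (simp add: right_diff_distrib)
  \<comment> \<open>The Lipschitz-type condition trades the two values of \<open>f y0\<close> in
    \<open>step1\<close> for \<open>f y1 y2\<close>, the value left over from
    \<open>step2\<close>.\<close>
  have "f y0 y2 - f y0 y1 - f y1 y2 \<le> c1 * (norm (y1 - y0))\<^sup>2 + c2 * (norm (y2 - y1))\<^sup>2"
    using lip[unfolded lipschitz_type_on_def, rule_format, OF yC]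
    by (simp add: norm_minus_commute[of y0 y1] norm_minus_commute[of y1 y2])
  then have "lam * (f y0 y2 - f y0 y1 - f y1 y2) \<le> lam * (c1 * (norm (y1 - y0))\<^sup>2 + c2 * (norm (y2 - y1))\<^sup>2)"
    using pos by (intro mult_left_mono) auto
  then have B: "(x0 - y1) \<bullet> (y2 - y1) - lam * f y1 y2 \<le> lam * c1 * (norm (y1 - y0))\<^sup>2 + lam * c2 * (norm (y2 - y1))\<^sup>2"
    using step1 by (simp add: algebra_simps)
  \<comment> \<open>Young's inequality with weight 1.\<close>
  have "0 \<le> (norm ((x1 - x0) + (x0 - y1)))\<^sup>2" by simp
  then have Y1: "- 2 * ((x1 - x0) \<bullet> (x0 - y1)) \<le> (norm (x1 - x0))\<^sup>2 + (norm (x0 - y1))\<^sup>2"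
    unfolding power2_norm_eq_inner inner_add_left inner_add_right by (simp add: inner_commute)
  have expand: "(norm (k *\<^sub>R p + q))\<^sup>2 / k = k * (norm p)\<^sup>2 + 2 * (p \<bullet> q) + 1 / k * (norm q)\<^sup>2"
    for p q :: 'a
    unfolding power2_norm_eq_inner inner_add_left inner_add_right
    using pos by (simp add: inner_commute field_simps)
  \<comment> \<open>Young's inequality with weight \<open>k\<close>: the origin of \<open>k\<close>
    and \<open>1 / k\<close> in \<open>eps\<close>.\<close>
  have "0 \<le> (norm (k *\<^sub>R (x1 - x0) + (y1 - y2)))\<^sup>2 / k" using pos by simp
  also note expand
  also note norm_minus_commute[of y1 y2]
  finally have Y2: "- 2 * ((x1 - x0) \<bullet> (y1 - y2)) \<le> k * (norm (x1 - x0))\<^sup>2 + 1 / k * (norm (y2 - y1))\<^sup>2"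
    by simp
  have I1: "(norm (y2 - z))\<^sup>2 = (norm (x1 - z))\<^sup>2 - (norm (x1 - y2))\<^sup>2 + 2 * ((x1 - y2) \<bullet> (z - y2))"
    by (simp add: power2_norm_eq_inner inner_diff_left inner_diff_right inner_commute)
  \<comment> \<open>Split \<open>x1 - y2\<close> into
    \<open>(x1 - x0) + (x0 - y1) + (y1 - y2)\<close>. The product of the last two summands cancels
    the term from \<open>step1\<close>; \<open>Y1\<close> uses up the squares of the first two, and
    \<open>Y2\<close> bounds the remaining product.\<close>
  have I2: "- (norm (x1 - y2))\<^sup>2 - 2 * ((x0 - y1) \<bullet> (y2 - y1)) =
     - (norm (x1 - x0))\<^sup>2 - 2 * ((x1 - x0) \<bullet> (x0 - y1)) - 2 * ((x1 - x0) \<bullet> (y1 - y2))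
     - (norm (x0 - y1))\<^sup>2 - (norm (y2 - y1))\<^sup>2"
    by (simp add: power2_norm_eq_inner inner_diff_left inner_diff_right inner_commute)
  have "(norm (y2 - z))\<^sup>2 \<le> (norm (x1 - z))\<^sup>2 + (k * (norm (x1 - x0))\<^sup>2
      + 2 * (lam * c1 * (norm (y1 - y0))\<^sup>2) - (norm (y2 - y1))\<^sup>2 + 1 / k * (norm (y2 - y1))\<^sup>2 + 2 * (lam * c2 * (norm (y2 - y1))\<^sup>2))"
    using A B Y1 Y2 I1 I2 by linarith
  then show ?thesis by (simp add: algebra_simps)
qed

text \<open>The left side of \<open>step\<close> pairs a null sequence with a bounded one. On the
  right, \<open>ys\<close> and \<open>zs\<close> share their weak limit, so
  \<open>f (ys n) (zs n)\<close> tends to \<open>f p p\<close>, which is 0.\<close>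

lemma weak_cluster_point_in_EP:
  fixes xs ys zs :: "nat \<Rightarrow> 'a::real_inner"
  assumes wc: "weakly_continuous_on C f" and diag: "f p p = 0" and p: "p \<in> C"
    and ysC: "\<And>n. ys n \<in> C" and zsC: "\<And>n. zs n \<in> C" and lam: "lam > 0"
    and lim: "weakly_tendsto ys p" "weakly_tendsto zs p" and bd: "\<And>n. norm (zs n) \<le> B"
    and diff: "(\<lambda>n. xs n - zs n) \<longlonglongrightarrow> 0"
    and step: "\<And>n v. v \<in> C \<Longrightarrow> (xs n - zs n) \<bullet> (v - zs n) \<le> lam * (f (ys n) v - f (ys n) (zs n))"
  shows "p \<in> EP f C"
  unfolding EP_def
proof (intro CollectI conjI ballI p)
  fix v assume v: "v \<in> C"
  have "(\<lambda>n. (xs n - zs n) \<bullet> (v - zs n)) \<longlonglongrightarrow> 0"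
  proof (rule Lim_null_comparison)
    show "(\<lambda>n. norm (xs n - zs n) * (norm v + B)) \<longlonglongrightarrow> 0"
      by (rule tendsto_mult_left_zero) (rule tendsto_norm_zero[OF diff])
    have "norm ((xs n - zs n) \<bullet> (v - zs n)) \<le> norm (xs n - zs n) * (norm v + B)" for n
    proof -
      have "norm (v - zs n) \<le> norm v + B" using norm_triangle_ineq4[of v "zs n"] bd[of n] by simp
      then have "norm (xs n - zs n) * norm (v - zs n) \<le> norm (xs n - zs n) * (norm v + B)"
        by (intro mult_left_mono) auto
      then show ?thesis using Cauchy_Schwarz_ineq2[of "xs n - zs n" "v - zs n"] by simp
    qed
    then show "\<forall>\<^sub>F n in sequentially. norm ((xs n - zs n) \<bullet> (v - zs n)) \<le> norm (xs n - zs n) * (norm v + B)"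
      by simp
  qed
  moreover have "(\<lambda>n. lam * (f (ys n) v - f (ys n) (zs n))) \<longlonglongrightarrow> lam * (f p v - f p p)"
    by (intro tendsto_intros weakly_continuous_on_tendsto[OF wc] ysC zsC p v lim
        tendsto_imp_weakly_tendsto)
  ultimately have "0 \<le> lam * (f p v - f p p)"
    by (rule LIMSEQ_le) (use step[OF v] in blast)
  then show "0 \<le> f p v" using lam diag by (simp add: zero_le_mult_iff)
qed

text \<open>Sum the recursion: the shifted sum differs from the sum of \<open>a\<close> only by
  \<open>a m - a 0\<close>, so \<open>b - c\<close> times the partial sums stays below a
  constant.\<close>

lemma summable_perturbed_contraction:
  fixes a r :: "nat \<Rightarrow> real"
  assumes a: "\<And>n. 0 \<le> a n" and r: "\<And>n. 0 \<le> r n" "summable r" and cb: "0 \<le> c" "c < b"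
    and rec: "\<And>n. b * a (Suc n) \<le> c * a n + r n"
  shows "summable a"
proof (rule summableI_nonneg_bounded[OF a])
  fix m
  have "(\<Sum>n<m. b * a (Suc n)) \<le> (\<Sum>n<m. c * a n + r n)" by (intro sum_mono rec)
  then have "b * (\<Sum>n<m. a (Suc n)) \<le> c * (\<Sum>n<m. a n) + (\<Sum>n<m. r n)"
    by (simp add: sum.distrib sum_distrib_left)
  moreover have "(\<Sum>n<m. r n) \<le> suminf r" using r by (intro sum_le_suminf) auto
  moreover have "(\<Sum>n<m. a (Suc n)) = (\<Sum>n<m. a n) + a m - a 0"
    by (induction m) auto
  moreover have "0 \<le> b * a m" using a cb by simp
  ultimately have "(b - c) * (\<Sum>n<m. a n) \<le> b * a 0 + suminf r"
    by (simp add: algebra_simps)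
  then show "(\<Sum>n<m. a n) \<le> (b * a 0 + suminf r) / (b - c)"
    using cb by (simp add: field_simps)
qed

text \<open>The terms quadratic in \<open>z\<close> cancel, leaving a possibly degenerate
  half-space.\<close>

lemma closed_convex_bisector:
  fixes p q :: "'a::real_inner"
  shows "closed {z. (norm (q - z))\<^sup>2 \<le> (norm (p - z))\<^sup>2 + e}" (is "closed ?S")
    and "convex {z. (norm (q - z))\<^sup>2 \<le> (norm (p - z))\<^sup>2 + e}"
proof -
  have "?S = {z. (2 *\<^sub>R (p - q)) \<bullet> z \<le> p \<bullet> p - q \<bullet> q + e}"
    by (auto simp: power2_norm_eq_inner inner_diff_left inner_diff_right inner_commute)
  then show "closed ?S" "convex ?S"
    by (simp_all only: closed_halfspace_le convex_halfspace_le)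
qed

text \<open>With \<open>u\<close> the projection, \<open>le\<close> bounds the squared distance to
  \<open>u\<close> by \<open>2 * ((x n - u) \<bullet> (a - u))\<close>, which is linear in
  \<open>x n\<close> and so passes to weak limits. A subsequence staying \<open>e\<close> away from
  \<open>u\<close> would make the limit at least \<open>e\<^sup>2\<close>, while the projection
  inequality makes it at most 0.\<close>

lemma tendsto_if_weak_cluster_points:
  fixes x :: "nat \<Rightarrow> 'a::{real_inner, complete_space}"
  assumes F: "closed F" "convex F" "F \<noteq> {}"
    and le: "\<And>n. norm (x n - a) \<le> norm (metric_proj F a - a)"
    and cluster: "\<And>r p. strict_mono r \<Longrightarrow> weakly_tendsto (x \<circ> r) p \<Longrightarrow> p \<in> F"
  shows "x \<longlonglongrightarrow> metric_proj F a"
proof (rule ccontr)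
  define u where "u = metric_proj F a"
  assume "\<not> x \<longlonglongrightarrow> metric_proj F a"
  then obtain e where e: "e > 0" "\<not> (\<forall>\<^sub>F n in sequentially. dist (x n) u < e)"
    unfolding tendsto_iff u_def by blast
  then obtain r :: "nat \<Rightarrow> nat" where r: "strict_mono r" "\<And>n. \<not> dist (x (r n)) u < e"
    using not_eventually_sequentiallyD[OF e(2)] by blast
  have "norm (x n) \<le> norm (u - a) + norm a" for n
    using le[of n] norm_triangle_ineq[of "x n - a" a] unfolding u_def by simp
  then obtain r' p where r': "strict_mono r'" "weakly_tendsto ((x \<circ> r) \<circ> r') p"
    using bounded_weakly_convergent_subsequence[of "x \<circ> r"] by (metis comp_apply)
  define s where "s = r \<circ> r'"
  have s: "strict_mono s" "weakly_tendsto (x \<circ> s) p"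
    using r(1) r' by (auto simp: s_def strict_mono_o comp_assoc)
  have pF: "p \<in> F" using cluster s by blast
  have bound: "(norm (x n - u))\<^sup>2 \<le> 2 * ((x n - u) \<bullet> (a - u))" for n
  proof -
    have "(norm (x n - u))\<^sup>2 = (norm (x n - a))\<^sup>2 - (norm (u - a))\<^sup>2 + 2 * ((x n - u) \<bullet> (a - u))"
      by (simp add: power2_norm_eq_inner inner_diff_left inner_diff_right inner_commute)
    moreover have "(norm (x n - a))\<^sup>2 \<le> (norm (u - a))\<^sup>2"
      using le[of n] by (simp add: u_def power_mono)
    ultimately show ?thesis by simp
  qed
  have lim: "(\<lambda>n. 2 * ((x (s n) - u) \<bullet> (a - u))) \<longlonglongrightarrow> 2 * ((p - u) \<bullet> (a - u))"
    unfolding inner_diff_left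
    by (intro tendsto_mult tendsto_diff weakly_tendstoD[OF s(2), unfolded comp_def] tendsto_const)
  have "e\<^sup>2 \<le> 2 * ((x (s n) - u) \<bullet> (a - u))" for n
  proof -
    have "e \<le> norm (x (s n) - u)" using r(2)[of "r' n"] by (simp add: s_def dist_norm)
    then have "e\<^sup>2 \<le> (norm (x (s n) - u))\<^sup>2" using e(1) by (intro power_mono) auto
    then show ?thesis using bound[of "s n"] by simp
  qed
  then have "e\<^sup>2 \<le> 2 * ((p - u) \<bullet> (a - u))"
    by (intro LIMSEQ_le_const[OF lim]) blast
  moreover have "(a - u) \<bullet> (p - u) \<le> 0"
    unfolding u_def by (rule metric_proj_variational(2)[OF F pF])
  moreover have "0 < e\<^sup>2" using e(1) by simp
  ultimately show False by (simp add: inner_commute)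
qed

section \<open>Convergence of the hybrid method\<close>

lemma tendsto_zero_if_norm_sq:
  fixes d :: "nat \<Rightarrow> 'a::real_normed_vector"
  assumes "(\<lambda>n. (norm (d n))\<^sup>2) \<longlonglongrightarrow> 0"
  shows "d \<longlonglongrightarrow> 0"
proof -
  have "(\<lambda>n. sqrt ((norm (d n))\<^sup>2)) \<longlonglongrightarrow> sqrt 0"
    using assms by (rule tendsto_real_sqrt)
  then show ?thesis by (simp add: tendsto_norm_zero_iff)
qed

theorem theorem1:
  fixes C :: "'a::{real_inner, complete_space} set"
    and N :: nat
    and f :: "nat \<Rightarrow> 'a \<Rightarrow> 'a \<Rightarrow> real"
    and c1 c2 lam k :: real
    and F :: "'a set"
    and x :: "nat \<Rightarrow> 'a"
    and y :: "nat \<Rightarrow> nat \<Rightarrow> 'a"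
    and eps :: "nat \<Rightarrow> nat \<Rightarrow> real"
    and Cs Qs :: "nat \<Rightarrow> 'a set"
  assumes "C \<noteq> {}" and "closed C" and "convex C" and "N \<ge> 1"
    and "c1 > 0" and "c2 > 0"
    and "\<And>i. i \<in> {1..N} \<Longrightarrow> pseudomonotone_on C (f i)"
    and "\<And>i u. i \<in> {1..N} \<Longrightarrow> u \<in> C \<Longrightarrow> f i u u = 0"
    and "\<And>i. i \<in> {1..N} \<Longrightarrow> lipschitz_type_on c1 c2 C (f i)"
    and "\<And>i. i \<in> {1..N} \<Longrightarrow> weakly_continuous_on C (f i)"
    and "\<And>i u. i \<in> {1..N} \<Longrightarrow> u \<in> C \<Longrightarrow> convex_on C (f i u)"
    and "\<And>i u. i \<in> {1..N} \<Longrightarrow> u \<in> C \<Longrightarrow> subdifferentiable_on C (f i u)"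
    and "F = (\<Inter>i\<in>{1..N}. EP (f i) C)" and "F \<noteq> {}"
    and "0 < lam" and "lam < 1 / (2 * (c1 + c2))"
    and "k > 1 / (1 - 2 * lam * (c1 + c2))"
    and "x 1 = x 0"
    and "\<And>i. i \<in> {1..N} \<Longrightarrow> y i 0 \<in> C"
    and "Cs 0 = UNIV" and "Qs 0 = UNIV"
    and "\<And>i n. i \<in> {1..N} \<Longrightarrow>
           y i (n + 1) = arg_min_on (\<lambda>v. lam * f i (y i n) v + 1/2 * (norm (x n - v))\<^sup>2) C"
    and "\<And>n. x (n + 1) = metric_proj (Cs n \<inter> Qs n) (x 0)"
    and "\<And>n. n \<ge> 1 \<Longrightarrow>
           Cs n = (\<Inter>i\<in>{1..N}. {z. (norm (y i (n + 1) - z))\<^sup>2 \<le> (norm (x n - z))\<^sup>2 + eps i n})"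
    and "\<And>n. n \<ge> 1 \<Longrightarrow> Qs n = {z. (x 0 - x n) \<bullet> (z - x n) \<le> 0}"
    and "\<And>i n. i \<in> {1..N} \<Longrightarrow> n \<ge> 1 \<Longrightarrow>
           eps i n = k * (norm (x n - x (n - 1)))\<^sup>2 + 2 * lam * c1 * (norm (y i n - y i (n - 1)))\<^sup>2
             - (1 - 1 / k - 2 * lam * c2) * (norm (y i (n + 1) - y i n))\<^sup>2"
  shows "x \<longlonglongrightarrow> metric_proj F (x 0) \<and> (\<forall>i\<in>{1..N}. y i \<longlonglongrightarrow> metric_proj F (x 0))"
proof -
  note C = \<open>closed C\<close> \<open>convex C\<close> \<open>C \<noteq> {}\<close>
  note pm = assms(7) and diag = assms(8) and lip = assms(9) and wc = assms(10)
    and cv = assms(11) and sd = assms(12) and F_def = assms(13)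
  note lam = \<open>0 < lam\<close> and y0 = assms(19)
  note y_step = assms(22) and x_step = assms(23) and Cs_def = assms(24)
    and Qs_def = assms(25) and eps_def = assms(26)
  \<comment> \<open>The coefficient of the negative term in \<open>eps\<close>. The bound on
    \<open>k\<close> says \<open>1 / k < 1 - 2 * lam * (c1 + c2)\<close>, that is
    \<open>2 * lam * c1 < del\<close>, the gap needed by
    \<open>summable_perturbed_contraction\<close>.\<close>
  define del where "del = 1 - 1 / k - 2 * lam * c2"
  have k: "k > 0" and del: "2 * lam * c1 < del" and c1: "0 \<le> 2 * lam * c1"
  proof -
    have "lam * (2 * (c1 + c2)) < 1"
      using assms(16) \<open>c1 > 0\<close> \<open>c2 > 0\<close> by (simp add: pos_less_divide_eq)
    then have D: "0 < 1 - 2 * lam * (c1 + c2)" by (simp add: algebra_simps)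
    then show k: "k > 0" using assms(17) by (meson divide_pos_pos less_trans zero_less_one)
    have "1 / k < 1 - 2 * lam * (c1 + c2)"
      using assms(17) D k by (simp add: field_simps)
    then show "2 * lam * c1 < del" by (simp add: del_def algebra_simps)
    show "0 \<le> 2 * lam * c1" using lam \<open>c1 > 0\<close> by simp
  qed

  \<comment> \<open>Iterates in \<open>C\<close> and the solution set\<close>
  have yC: "y i n \<in> C" if i: "i \<in> {1..N}" for i n
  proof (induction n)
    case 0 show ?case using y0 i by blast
  next
    case (Suc n)
    then show ?case
      using prox_step(1)[OF C lam weakly_continuous_on_imp_continuous_on(1)[OF wc] cv sd y_step] i
      by simp
  qed
  have y_var: "(x n - y i (Suc n)) \<bullet> (v - y i (Suc n)) \<le> lam * (f i (y i n) v - f i (y i n) (y i (Suc n)))"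
    if "i \<in> {1..N}" "v \<in> C" for i n v
    using prox_step(2)[OF C lam weakly_continuous_on_imp_continuous_on(1)[OF wc] cv sd y_step] yC that
    by simp
  have EP_cc: "closed (EP (f i) C)" "convex (EP (f i) C)" if "i \<in> {1..N}" for i
    using closed_convex_EP[OF C(1,2) pm diag wc cv] that by blast+
  have F: "closed F" "convex F" "F \<noteq> {}"
    unfolding F_def using EP_cc assms(14) F_def by (auto intro!: closed_INT convex_INT)
  have F_EP: "z \<in> EP (f i) C" if "z \<in> F" "i \<in> {1..N}" for z i
    using that F_def by blast

  \<comment> \<open>\<open>F\<close> inside the sets projected onto\<close>
  have Cs: "closed (Cs n) \<and> convex (Cs n) \<and> F \<subseteq> Cs n" for n
  proof (cases n)
    case 0 then show ?thesis using \<open>Cs 0 = UNIV\<close> by simp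
  next
    case (Suc m)
    then have n: "n \<ge> 1" by simp
    have "F \<subseteq> Cs n"
    proof
      fix z assume z: "z \<in> F"
      \<comment> \<open>The steps producing \<open>y i n\<close> and \<open>y i (n + 1)\<close> are
        paired. For \<open>n = 1\<close> the first is the step at index 0: \<open>y_step\<close>
        holds from there on, so \<open>y i 1\<close> is itself a proximal point.\<close>
      have "(norm (y i (n + 1) - z))\<^sup>2 \<le> (norm (x n - z))\<^sup>2 + eps i n" if i: "i \<in> {1..N}" for i
        using two_prox_steps_estimate[OF pm[OF i] lip[OF i] yC[OF i] yC[OF i] yC[OF i] F_EP[OF z i] lam k
            y_var[OF i yC[OF i], of m "Suc (Suc m)"] y_var[OF i, of z "Suc m"]] F_EP[OF z i]
        unfolding eps_def[OF i n] by (simp add: Suc EP_def)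
      then show "z \<in> Cs n" unfolding Cs_def[OF n] by blast
    qed
    then show ?thesis unfolding Cs_def[OF n]
      by (intro conjI closed_INT convex_INT ballI closed_convex_bisector) auto
  qed
  have Qs_cc: "closed (Qs n)" "convex (Qs n)" for n
  proof -
    have "Qs n = UNIV \<or> Qs n = {z. (x 0 - x n) \<bullet> z \<le> (x 0 - x n) \<bullet> x n}"
      using \<open>Qs 0 = UNIV\<close> Qs_def[of n] by (cases n) (auto simp: inner_diff_right)
    then show "closed (Qs n)" "convex (Qs n)"
      by (auto simp: closed_halfspace_le convex_halfspace_le)
  qed
  have CQ: "closed (Cs n \<inter> Qs n)" "convex (Cs n \<inter> Qs n)" for n
    using Cs Qs_cc by (auto intro: convex_Int)
  have FQ: "F \<subseteq> Qs n" for n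
  proof (induction n)
    case 0 then show ?case using \<open>Qs 0 = UNIV\<close> by simp
  next
    case (Suc n)
    \<comment> \<open>The projection inequality at \<open>x (Suc n)\<close>, tested at
      \<open>z\<close>, is exactly membership in \<open>Qs (Suc n)\<close>; the induction hypothesis
      puts \<open>z\<close> into the set projected onto.\<close>
    have "(x 0 - x (Suc n)) \<bullet> (z - x (Suc n)) \<le> 0" if "z \<in> F" for z
      using metric_proj_variational(2)[OF CQ, of n z "x 0"] x_step[of n] Cs[of n] Suc that by auto
    then show ?case using Qs_def[of "Suc n"] by auto
  qed
  have FCQ: "F \<subseteq> Cs n \<inter> Qs n" for n using Cs FQ by blast
  have x_mem: "x (Suc n) \<in> Cs n \<inter> Qs n" for n
    using metric_proj_variational(1)[OF CQ, of n "x 0"] FCQ[of n] F(3) x_step[of n] by auto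

  \<comment> \<open>Bounded distances and summable steps of \<open>x\<close>\<close>
  define u where "u = metric_proj F (x 0)"
  have uF: "u \<in> F" unfolding u_def by (rule metric_proj_variational(1)[OF F])
  have x_le: "norm (x n - x 0) \<le> norm (u - x 0)" for n
  proof (cases n)
    case (Suc m)
    have "(norm (x n - x 0))\<^sup>2 \<le> (norm (u - x 0))\<^sup>2"
      using norm_sq_metric_proj[OF CQ, of u m "x 0"] FCQ[of m] uF x_step[of m] Suc
        zero_le_power2[of "norm (u - metric_proj (Cs m \<inter> Qs m) (x 0))"]
      unfolding Suc_eq_plus1 by (metis diff_ge_0_iff_ge order_trans subsetD)
    then show ?thesis by simp
  qed simp
  define s where "s n = (norm (x (Suc n) - x n))\<^sup>2" for n
  \<comment> \<open>For \<open>n >= 1\<close>, membership of \<open>x (Suc n)\<close> in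
    \<open>Qs n\<close> makes the angle at \<open>x n\<close> non-acute; for \<open>n = 0\<close>
    equality holds. The right side telescopes.\<close>
  have s_le: "s n \<le> (norm (x (Suc n) - x 0))\<^sup>2 - (norm (x n - x 0))\<^sup>2" for n
  proof (cases n)
    case (Suc m)
    then have "(x 0 - x n) \<bullet> (x (Suc n) - x n) \<le> 0" using x_mem[of n] Qs_def[of n] by auto
    moreover have "s n = (norm (x (Suc n) - x 0))\<^sup>2 - (norm (x n - x 0))\<^sup>2
        + 2 * ((x 0 - x n) \<bullet> (x (Suc n) - x n))"
      unfolding s_def
      by (simp add: power2_norm_eq_inner inner_diff_left inner_diff_right inner_commute)
    ultimately show ?thesis by simp
  qed (simp add: s_def)
  have s_sum: "summable s"
  proof (rule summableI_nonneg_bounded)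
    fix m
    have "(\<Sum>n<m. s n) \<le> (norm (x m - x 0))\<^sup>2"
    proof (induction m)
      case (Suc m) then show ?case using s_le[of m] by simp
    qed simp
    also have "\<dots> \<le> (norm (u - x 0))\<^sup>2" using x_le by (simp add: power_mono)
    finally show "(\<Sum>n<m. s n) \<le> (norm (u - x 0))\<^sup>2" .
  qed (simp add: s_def)
  \<comment> \<open>The perturbation in the recursion for \<open>a\<close>: \<open>s (Suc n)\<close>
    comes from the distance in \<open>Cs (Suc n)\<close>, \<open>k * s n\<close> from
    \<open>eps i (Suc n)\<close>.\<close>
  define t where "t n = s (Suc n) + k * s n" for n
  have t: "summable t"
    unfolding t_def using s_sum by (intro summable_add summable_mult) (simp_all add: summable_Suc_iff)
  have t_nonneg: "0 \<le> t n" for n using k by (simp add: t_def s_def)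

  \<comment> \<open>Vanishing gaps of the iterates \<open>y i\<close>\<close>
  define a where "a i n = (norm (y i (Suc n) - y i n))\<^sup>2" for i n
  \<comment> \<open>\<open>x (Suc (Suc n))\<close> itself is inserted into the condition of
    \<open>Cs (Suc n)\<close>; the shift is due to \<open>Cs_def\<close> starting at 1. The bound
    serves twice: dropping its left side gives the recursion for \<open>a i\<close>, and once
    \<open>a i\<close> tends to 0 it gives \<open>yx\<close>.\<close>
  have gap: "(norm (y i (Suc (Suc n)) - x (Suc (Suc n))))\<^sup>2 \<le> 2 * lam * c1 * a i n + t n - del * a i (Suc n)"
    if i: "i \<in> {1..N}" for i n
  proof -
    have "x (Suc (Suc n)) \<in> Cs (Suc n)" using x_mem by blast
    then have "(norm (y i (Suc (Suc n)) - x (Suc (Suc n))))\<^sup>2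
        \<le> (norm (x (Suc n) - x (Suc (Suc n))))\<^sup>2 + eps i (Suc n)"
      using Cs_def[of "Suc n"] i by auto
    then show ?thesis
      unfolding eps_def[OF i, of "Suc n", simplified]
      by (simp add: t_def s_def a_def del_def norm_minus_commute)
  qed
  have a_sum: "summable (a i)" if i: "i \<in> {1..N}" for i
  proof (rule summable_perturbed_contraction[OF _ t_nonneg t c1 del])
    show "0 \<le> a i n" for n by (simp add: a_def)
    show "del * a i (Suc n) \<le> 2 * lam * c1 * a i n + t n" for n
      using gap[OF i, of n] zero_le_power2[of "norm (y i (Suc (Suc n)) - x (Suc (Suc n)))"] by linarith
  qed
  have y_diff: "(\<lambda>n. y i (Suc n) - y i n) \<longlonglongrightarrow> 0" if i: "i \<in> {1..N}" for i
    using summable_LIMSEQ_zero[OF a_sum[OF i]] unfolding a_def by (rule tendsto_zero_if_norm_sq)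
  have yx: "(\<lambda>n. y i n - x n) \<longlonglongrightarrow> 0" if i: "i \<in> {1..N}" for i
  proof -
    have "(\<lambda>n. 2 * lam * c1 * a i n + t n - del * a i (Suc n)) \<longlonglongrightarrow> 2 * lam * c1 * 0 + 0 - del * 0"
      using summable_LIMSEQ_zero[OF a_sum[OF i]] summable_LIMSEQ_zero[OF t]
      by (intro tendsto_add tendsto_diff tendsto_mult tendsto_const LIMSEQ_Suc)
    then have "(\<lambda>n. 2 * lam * c1 * a i n + t n - del * a i (Suc n)) \<longlonglongrightarrow> 0" by simp
    then have "(\<lambda>n. (norm (y i (Suc (Suc n)) - x (Suc (Suc n))))\<^sup>2) \<longlonglongrightarrow> 0"
      by (rule Lim_null_comparison[rotated]) (use gap[OF i] in simp)
    then have "(\<lambda>n. y i (Suc (Suc n)) - x (Suc (Suc n))) \<longlonglongrightarrow> 0"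
      by (rule tendsto_zero_if_norm_sq)
    then show ?thesis
      using LIMSEQ_offset[of "\<lambda>n. y i n - x n" 2 0] by (simp add: numeral_2_eq_2)
  qed

  \<comment> \<open>Identification of the limit\<close>
  have x_bd: "norm (x n) \<le> norm (u - x 0) + norm (x 0)" for n
    using x_le[of n] norm_triangle_ineq[of "x n - x 0" "x 0"] by simp
  have x_lim: "x \<longlonglongrightarrow> u"
    unfolding u_def
  proof (rule tendsto_if_weak_cluster_points[OF F])
    show "norm (x n - x 0) \<le> norm (metric_proj F (x 0) - x 0)" for n
      using x_le by (simp add: u_def)
    fix r :: "nat \<Rightarrow> nat" and p assume r: "strict_mono r" and w: "weakly_tendsto (x \<circ> r) p"
    have "p \<in> EP (f i) C" if i: "i \<in> {1..N}" for i
    proof -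
      \<comment> \<open>Both \<open>y i (r n)\<close> and its successor stay asymptotically at
        \<open>x (r n)\<close>, so they inherit the weak limit \<open>p\<close> although the
        successor sequence is not indexed by \<open>r\<close>.\<close>
      have yr: "(\<lambda>n. y i (r n) - x (r n)) \<longlonglongrightarrow> 0"
        using LIMSEQ_subseq_LIMSEQ[OF yx[OF i] r] by (simp add: comp_def)
      have yr': "(\<lambda>n. y i (Suc (r n)) - y i (r n)) \<longlonglongrightarrow> 0"
        using LIMSEQ_subseq_LIMSEQ[OF y_diff[OF i] r] by (simp add: comp_def)
      have yr'': "(\<lambda>n. y i (Suc (r n)) - x (r n)) \<longlonglongrightarrow> 0"
        using tendsto_add[OF yr yr'] by simp
      have w1: "weakly_tendsto (\<lambda>n. y i (r n)) p"
        using weakly_tendsto_transfer[OF w] yr by simp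
      have w2: "weakly_tendsto (\<lambda>n. y i (Suc (r n))) p"
        using weakly_tendsto_transfer[OF w] yr'' by simp
      have p: "p \<in> C" using weakly_closed[OF C(1,2) yC[OF i] w1] .
      obtain B where B: "\<And>n. norm (y i n) \<le> B"
      proof -
        have "Bseq (\<lambda>n. y i n - x n)" using yx[OF i] convergentI convergent_imp_Bseq by blast
        then obtain K where K: "\<And>n. norm (y i n - x n) \<le> K" by (auto simp: Bseq_def)
        have "norm (y i n) \<le> K + (norm (u - x 0) + norm (x 0))" for n
          using K[of n] x_bd[of n] norm_triangle_ineq[of "y i n - x n" "x n"] by simp
        then show ?thesis using that by blast
      qed
      show ?thesis
      proof (rule weak_cluster_point_in_EP[OF wc[OF i] diag[OF i p] p _ _ lam w1 w2])
        show "(\<lambda>n. x (r n) - y i (Suc (r n))) \<longlonglongrightarrow> 0"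
          using tendsto_minus[OF yr''] by simp
      qed (use yC[OF i] B y_var[OF i] in auto)
    qed
    then show "p \<in> F" using F_def by blast
  qed
  have "y i \<longlonglongrightarrow> u" if i: "i \<in> {1..N}" for i
    using tendsto_add[OF yx[OF i] x_lim] by simp
  then show ?thesis using x_lim unfolding u_def by blast
qed

end
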